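(* Let $\mathcal{Q}$ be a posetal model category all of whose morphisms are cofibrations. Let $\perp\to\tilde U\to\top$ be a factorization of the unique morphism from the initial object $\perp$ to the terminal object $\top$ such that $\perp\to\tilde U$ is a weak equivalence and a cofibration, and $p:\tilde U\to\top$ is a fibration. Define a fibration $Y\to X$ to be small if the morphism $\perp\to Y$ is a weak equivalence and a cofibration. Then the fibration $p:\tilde U\to\top$ is universal, i.e. every small fibration is $p$-small. If, in addition, $\mathcal{Q}$ is locally (w/f)-Cartesian closed, then $\mathcal{Q}$ meets the Univalence Axiom with respect to this notion of small fibrations, i.e. the universal fibration $p$ is univalent.
   Context: **Model category.** A model category (in the sense of Quillen 1967) is a category with three distinguished classes of morphisms, fibrations (f), cofibrations (c) and weak equivalences (w), satisfying: (M0) finite limits and colimits exist; (M1) every cofibration has the left lifting property with respect to every fibration whenever at least one of the two is a weak equivalence; (M2) every morphism factors as a cofibration-and-weak-equivalence followed by a fibration, and also as a cofibration followed by a fibration-and-weak-equivalence; (M3) fibrations are stable under composition and base change, cofibrations are stable under composition and cobase change, and isomorphisms are both fibrations and cofibrations; (M4) the base change of a morphism that is a fibration and a weak equivalence is a weak equivalence, and the cobase change of a morphism that is a cofibration and a weak equivalence is a weak equivalence; (M5) weak equivalences satisfy two-out-of-three, and isomorphisms are weak equivalences. An object $B$ is fibrant if $B\to\top$ is a fibration. For an object $X$, the slice $\mathcal{C}/X$ is a model category in which a morphism is (f), (c) or (w) iff its underlying morphism in $\mathcal{C}$ is. **Posetal.** A category is posetal if there is at most one morphism between any two given objects. **Universal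 fibration.** Given a morphism $p:\tilde U\to U$, a morphism $f:Y\to X$ is $p$-small if it is a pullback of $p$ along some morphism $X\to U$. Given a class of fibrations called small, a fibration $p$ is universal if every small fibration is $p$-small. **(w/f)-Cartesian closed.** For objects $Z,B,C$ of a model category $\mathcal{C}$ put $$Hom^{(w)}(Z\times B,C)=\{h:Z\times B\to C \mid (\mathrm{pr}_Z,h):Z\times B\to Z\times C \text{ is a weak equivalence}\}\subseteq Hom(Z\times B,C).$$ $\mathcal{C}$ is (w/f)-Cartesian closed if it is Cartesian closed and, for all fibrant $B,C$, the assignment $Z\mapsto Hom^{(w)}(Z\times B,C)$ is a (contravariant) subfunctor of $Hom(-\times B,C)$ and is representable. The representing object is denoted $C^B_w$, so $Hom^{(w)}(Z\times B,C)\cong Hom(Z,C^B_w)$ naturally in $Z$. $\mathcal{C}$ is locally (w/f)-Cartesian closed if every slice $\mathcal{C}/X$ is (w/f)-Cartesian closed. **Univalent fibration.** Let $\mathcal{C}$ be locally (w/f)-Cartesian closed and $q:E\to B$ a fibration. In $\mathcal{C}/(B\times B)$ consider the objects: - $B_\delta$, given by the diagonal $\delta:B\to B\times B$; - $E\underline{\times}B$, given by $(q\circ \mathrm{pr}_E,\mathrm{pr}_B):E\times B\to B\times B$; - $B\underline{\times}E$, given by $\tau\circ(q\circ \mathrm{pr}_E,\mathrm{pr}_B):E\times B\to B\times B$, where $\tau$ swaps the two factors of $B\times B$. Since $\tau\circ\delta=\delta$, the projection from the source of the product $B_\delta\times(E\underline{\times}B)$ (taken in $\mathcal{C}/(B\times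 B)$, i.e. the pullback over $B\times B$) to $E\times B$ is a morphism $h:B_\delta\times (E\underline{\times}B)\to B\underline{\times}E$ in $\mathcal{C}/(B\times B)$. It lies in $Hom^{(w)}_{B\times B}(B_\delta\times(E\underline{\times}B),B\underline{\times}E)$, because the induced morphism $B_\delta\times (E\underline{\times}B)\to B_\delta\times (B\underline{\times}E)$ is an isomorphism. Hence $h$ corresponds to a unique morphism $m_q:B_\delta\to \big((B\underline{\times}E)^{E\underline{\times}B}\big)_w$ in $\mathcal{C}/(B\times B)$. The fibration $q$ is univalent if $m_q$ is a weak equivalence. *)

theory Defs
  imports Main
begin

section \<open>Categories\<close>

text \<open>\<open>Comp C g f\<close>, written \<open>g \<cdot>\<^bsub>C\<^esub> f\<close>, is ``\<open>g\<close> after \<open>f\<close>''.  All operations are only meaningful on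
  the carriers \<open>Ob C\<close> and \<open>Ar C\<close>.\<close>

record ('o, 'a) cat =
  Ob :: "'o set"
  Ar :: "'a set"
  Dom :: "'a \<Rightarrow> 'o"
  Cod :: "'a \<Rightarrow> 'o"
  Idn :: "'o \<Rightarrow> 'a"
  Comp :: "'a \<Rightarrow> 'a \<Rightarrow> 'a"  (infixl "\<cdot>\<index>" 70)

definition hom :: "('o, 'a, 'z) cat_scheme \<Rightarrow> 'o \<Rightarrow> 'o \<Rightarrow> 'a set" where
  "hom C A B = {f \<in> Ar C. Dom C f = A \<and> Cod C f = B}"

definition category :: "('o, 'a, 'z) cat_scheme \<Rightarrow> bool" where
  "category C \<longleftrightarrow>
     (\<forall>f\<in>Ar C. Dom C f \<in> Ob C \<and> Cod C f \<in> Ob C) \<and>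
     (\<forall>A\<in>Ob C. Idn C A \<in> hom C A A) \<and>
     (\<forall>f\<in>Ar C. \<forall>g\<in>Ar C. Cod C f = Dom C g \<longrightarrow> g \<cdot>\<^bsub>C\<^esub> f \<in> hom C (Dom C f) (Cod C g)) \<and>
     (\<forall>f\<in>Ar C. f \<cdot>\<^bsub>C\<^esub> Idn C (Dom C f) = f \<and> Idn C (Cod C f) \<cdot>\<^bsub>C\<^esub> f = f) \<and>
     (\<forall>f\<in>Ar C. \<forall>g\<in>Ar C. \<forall>h\<in>Ar C. Cod C f = Dom C g \<longrightarrow> Cod C g = Dom C h \<longrightarrow>
        h \<cdot>\<^bsub>C\<^esub> (g \<cdot>\<^bsub>C\<^esub> f) = (h \<cdot>\<^bsub>C\<^esub> g) \<cdot>\<^bsub>C\<^esub> f)"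

definition posetal :: "('o, 'a, 'z) cat_scheme \<Rightarrow> bool" where
  "posetal C \<longleftrightarrow> (\<forall>f\<in>Ar C. \<forall>g\<in>Ar C. Dom C f = Dom C g \<longrightarrow> Cod C f = Cod C g \<longrightarrow> f = g)"

definition iso :: "('o, 'a, 'z) cat_scheme \<Rightarrow> 'a \<Rightarrow> bool" where
  "iso C f \<longleftrightarrow> f \<in> Ar C \<and>
     (\<exists>g\<in>hom C (Cod C f) (Dom C f). g \<cdot>\<^bsub>C\<^esub> f = Idn C (Dom C f) \<and> f \<cdot>\<^bsub>C\<^esub> g = Idn C (Cod C f))"

definition terminal :: "('o, 'a, 'z) cat_scheme \<Rightarrow> 'o \<Rightarrow> bool" where
  "terminal C T \<longleftrightarrow> T \<in> Ob C \<and> (\<forall>A\<in>Ob C. \<exists>!f. f \<in> hom C A T)"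

definition initial :: "('o, 'a, 'z) cat_scheme \<Rightarrow> 'o \<Rightarrow> bool" where
  "initial C I \<longleftrightarrow> I \<in> Ob C \<and> (\<forall>A\<in>Ob C. \<exists>!f. f \<in> hom C I A)"


section \<open>Finite limits and colimits\<close>

definition cat_functor ::
    "('i, 'j, 'y) cat_scheme \<Rightarrow> ('o, 'a, 'z) cat_scheme \<Rightarrow> ('i \<Rightarrow> 'o) \<Rightarrow> ('j \<Rightarrow> 'a) \<Rightarrow> bool" where
  "cat_functor J C F0 F1 \<longleftrightarrow>
     (\<forall>i\<in>Ob J. F0 i \<in> Ob C) \<and>
     (\<forall>u\<in>Ar J. F1 u \<in> hom C (F0 (Dom J u)) (F0 (Cod J u))) \<and>
     (\<forall>i\<in>Ob J. F1 (Idn J i) = Idn C (F0 i)) \<and>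
     (\<forall>u\<in>Ar J. \<forall>v\<in>Ar J. Cod J u = Dom J v \<longrightarrow> F1 (v \<cdot>\<^bsub>J\<^esub> u) = F1 v \<cdot>\<^bsub>C\<^esub> F1 u)"

definition cone ::
    "('i, 'j, 'y) cat_scheme \<Rightarrow> ('o, 'a, 'z) cat_scheme \<Rightarrow> ('i \<Rightarrow> 'o) \<Rightarrow> ('j \<Rightarrow> 'a) \<Rightarrow>
     'o \<Rightarrow> ('i \<Rightarrow> 'a) \<Rightarrow> bool" where
  "cone J C F0 F1 L l \<longleftrightarrow> L \<in> Ob C \<and> (\<forall>i\<in>Ob J. l i \<in> hom C L (F0 i)) \<and>
     (\<forall>u\<in>Ar J. F1 u \<cdot>\<^bsub>C\<^esub> l (Dom J u) = l (Cod J u))"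

definition cocone ::
    "('i, 'j, 'y) cat_scheme \<Rightarrow> ('o, 'a, 'z) cat_scheme \<Rightarrow> ('i \<Rightarrow> 'o) \<Rightarrow> ('j \<Rightarrow> 'a) \<Rightarrow>
     'o \<Rightarrow> ('i \<Rightarrow> 'a) \<Rightarrow> bool" where
  "cocone J C F0 F1 L l \<longleftrightarrow> L \<in> Ob C \<and> (\<forall>i\<in>Ob J. l i \<in> hom C (F0 i) L) \<and>
     (\<forall>u\<in>Ar J. l (Cod J u) \<cdot>\<^bsub>C\<^esub> F1 u = l (Dom J u))"

definition is_limit ::
    "('i, 'j, 'y) cat_scheme \<Rightarrow> ('o, 'a, 'z) cat_scheme \<Rightarrow> ('i \<Rightarrow> 'o) \<Rightarrow> ('j \<Rightarrow> 'a) \<Rightarrow>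
     'o \<Rightarrow> ('i \<Rightarrow> 'a) \<Rightarrow> bool" where
  "is_limit J C F0 F1 L l \<longleftrightarrow> cone J C F0 F1 L l \<and>
     (\<forall>K k. cone J C F0 F1 K k \<longrightarrow> (\<exists>!t. t \<in> hom C K L \<and> (\<forall>i\<in>Ob J. l i \<cdot>\<^bsub>C\<^esub> t = k i)))"

definition is_colimit ::
    "('i, 'j, 'y) cat_scheme \<Rightarrow> ('o, 'a, 'z) cat_scheme \<Rightarrow> ('i \<Rightarrow> 'o) \<Rightarrow> ('j \<Rightarrow> 'a) \<Rightarrow>
     'o \<Rightarrow> ('i \<Rightarrow> 'a) \<Rightarrow> bool" where
  "is_colimit J C F0 F1 L l \<longleftrightarrow> cocone J C F0 F1 L l \<and>
     (\<forall>K k. cocone J C F0 F1 K k \<longrightarrow> (\<exists>!t. t \<in> hom C L K \<and> (\<forall>i\<in>Ob J. t \<cdot>\<^bsub>C\<^esub> l i = k i)))"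

text \<open>Every finite category is isomorphic to one whose objects and arrows are natural numbers, so
  shapes of type \<open>(nat, nat) cat\<close> are no restriction.\<close>

definition finite_shape :: "(nat, nat) cat \<Rightarrow> bool" where
  "finite_shape J \<longleftrightarrow> category J \<and> finite (Ob J) \<and> finite (Ar J)"

definition has_finite_limits :: "('o, 'a, 'z) cat_scheme \<Rightarrow> bool" where
  "has_finite_limits C \<longleftrightarrow>
     (\<forall>J F0 F1. finite_shape J \<and> cat_functor J C F0 F1 \<longrightarrow> (\<exists>L l. is_limit J C F0 F1 L l))"

definition has_finite_colimits :: "('o, 'a, 'z) cat_scheme \<Rightarrow> bool" where
  "has_finite_colimits C \<longleftrightarrow>
     (\<forall>J F0 F1. finite_shape J \<and> cat_functor J C F0 F1 \<longrightarrow> (\<exists>L l. is_colimit J C F0 F1 L l))"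

text \<open>\<open>is_pullback C f g f' g'\<close>: the square \<open>f \<cdot> g' = g \<cdot> f'\<close> is Cartesian; so \<open>f'\<close> is the base change
  of \<open>f\<close> along \<open>g\<close> (and \<open>g'\<close> that of \<open>g\<close> along \<open>f\<close>).\<close>

definition is_pullback :: "('o, 'a, 'z) cat_scheme \<Rightarrow> 'a \<Rightarrow> 'a \<Rightarrow> 'a \<Rightarrow> 'a \<Rightarrow> bool" where
  "is_pullback C f g f' g' \<longleftrightarrow>
     f \<in> Ar C \<and> g \<in> Ar C \<and> f' \<in> Ar C \<and> g' \<in> Ar C \<and>
     Cod C f = Cod C g \<and> Dom C f' = Dom C g' \<and> Cod C f' = Dom C g \<and> Cod C g' = Dom C f \<and>
     f \<cdot>\<^bsub>C\<^esub> g' = g \<cdot>\<^bsub>C\<^esub> f' \<and>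
     (\<forall>K\<in>Ob C. \<forall>x\<in>hom C K (Dom C f). \<forall>y\<in>hom C K (Dom C g). f \<cdot>\<^bsub>C\<^esub> x = g \<cdot>\<^bsub>C\<^esub> y \<longrightarrow>
        (\<exists>!t. t \<in> hom C K (Dom C f') \<and> g' \<cdot>\<^bsub>C\<^esub> t = x \<and> f' \<cdot>\<^bsub>C\<^esub> t = y))"

text \<open>\<open>is_pushout C f g f' g'\<close>: the square \<open>g' \<cdot> f = f' \<cdot> g\<close> is co-Cartesian; so \<open>f'\<close> is the cobase
  change of \<open>f\<close> along \<open>g\<close>.\<close>

definition is_pushout :: "('o, 'a, 'z) cat_scheme \<Rightarrow> 'a \<Rightarrow> 'a \<Rightarrow> 'a \<Rightarrow> 'a \<Rightarrow> bool" where
  "is_pushout C f g f' g' \<longleftrightarrow>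
     f \<in> Ar C \<and> g \<in> Ar C \<and> f' \<in> Ar C \<and> g' \<in> Ar C \<and>
     Dom C f = Dom C g \<and> Cod C f' = Cod C g' \<and> Dom C f' = Cod C g \<and> Dom C g' = Cod C f \<and>
     g' \<cdot>\<^bsub>C\<^esub> f = f' \<cdot>\<^bsub>C\<^esub> g \<and>
     (\<forall>K\<in>Ob C. \<forall>x\<in>hom C (Cod C f) K. \<forall>y\<in>hom C (Cod C g) K. x \<cdot>\<^bsub>C\<^esub> f = y \<cdot>\<^bsub>C\<^esub> g \<longrightarrow>
        (\<exists>!t. t \<in> hom C (Cod C f') K \<and> t \<cdot>\<^bsub>C\<^esub> g' = x \<and> t \<cdot>\<^bsub>C\<^esub> f' = y))"


section \<open>Binary products\<close>

definition is_product :: "('o, 'a, 'z) cat_scheme \<Rightarrow> 'o \<Rightarrow> 'o \<Rightarrow> 'o \<Rightarrow> 'a \<Rightarrow> 'a \<Rightarrow> bool" where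
  "is_product C A B P a b \<longleftrightarrow> P \<in> Ob C \<and> a \<in> hom C P A \<and> b \<in> hom C P B \<and>
     (\<forall>K\<in>Ob C. \<forall>x\<in>hom C K A. \<forall>y\<in>hom C K B.
        \<exists>!t. t \<in> hom C K P \<and> a \<cdot>\<^bsub>C\<^esub> t = x \<and> b \<cdot>\<^bsub>C\<^esub> t = y)"

definition has_binary_products :: "('o, 'a, 'z) cat_scheme \<Rightarrow> bool" where
  "has_binary_products C \<longleftrightarrow> (\<forall>A\<in>Ob C. \<forall>B\<in>Ob C. \<exists>P a b. is_product C A B P a b)"

text \<open>An arbitrary but fixed choice of products; it is only used where products exist, and the
  notions built from it do not depend on the choice.\<close>

definition product_cone :: "('o, 'a, 'z) cat_scheme \<Rightarrow> 'o \<Rightarrow> 'o \<Rightarrow> 'o \<times> 'a \<times> 'a" where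
  "product_cone C A B = (SOME (P, a, b). is_product C A B P a b)"

definition prd :: "('o, 'a, 'z) cat_scheme \<Rightarrow> 'o \<Rightarrow> 'o \<Rightarrow> 'o" where
  "prd C A B = fst (product_cone C A B)"

definition pr1 :: "('o, 'a, 'z) cat_scheme \<Rightarrow> 'o \<Rightarrow> 'o \<Rightarrow> 'a" where
  "pr1 C A B = fst (snd (product_cone C A B))"

definition pr2 :: "('o, 'a, 'z) cat_scheme \<Rightarrow> 'o \<Rightarrow> 'o \<Rightarrow> 'a" where
  "pr2 C A B = snd (snd (product_cone C A B))"

definition pairing :: "('o, 'a, 'z) cat_scheme \<Rightarrow> 'o \<Rightarrow> 'o \<Rightarrow> 'a \<Rightarrow> 'a \<Rightarrow> 'a" where
  "pairing C A B f g =
     (THE t. t \<in> hom C (Dom C f) (prd C A B) \<and> pr1 C A B \<cdot>\<^bsub>C\<^esub> t = f \<and> pr2 C A B \<cdot>\<^bsub>C\<^esub> t = g)"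

text \<open>For \<open>k : Z' \<rightarrow> Z\<close>, the arrow \<open>k \<times> B : Z' \<times> B \<rightarrow> Z \<times> B\<close>.\<close>

definition times_right :: "('o, 'a, 'z) cat_scheme \<Rightarrow> 'a \<Rightarrow> 'o \<Rightarrow> 'a" where
  "times_right C k B =
     pairing C (Cod C k) B (k \<cdot>\<^bsub>C\<^esub> pr1 C (Dom C k) B) (pr2 C (Dom C k) B)"


section \<open>Subfunctors of \<open>Hom(- \<times> B, D)\<close> and exponentials\<close>

definition is_subfunctor :: "('o, 'a, 'z) cat_scheme \<Rightarrow> 'o \<Rightarrow> 'o \<Rightarrow> ('o \<Rightarrow> 'a set) \<Rightarrow> bool" where
  "is_subfunctor C B D S \<longleftrightarrow>
     (\<forall>Z\<in>Ob C. S Z \<subseteq> hom C (prd C Z B) D) \<and>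
     (\<forall>k\<in>Ar C. \<forall>h\<in>S (Cod C k). h \<cdot>\<^bsub>C\<^esub> times_right C k B \<in> S (Dom C k))"

text \<open>\<open>\<phi>\<close> is an isomorphism from \<open>Hom(-, W)\<close> to the subfunctor \<open>S\<close> of some \<open>Hom(- \<times> B, D)\<close>, natural
  in the argument \<open>Z\<close>.\<close>

definition represents ::
    "('o, 'a, 'z) cat_scheme \<Rightarrow> 'o \<Rightarrow> ('o \<Rightarrow> 'a set) \<Rightarrow> 'o \<Rightarrow> ('o \<Rightarrow> 'a \<Rightarrow> 'a) \<Rightarrow> bool" where
  "represents C B S W \<phi> \<longleftrightarrow> W \<in> Ob C \<and>
     (\<forall>Z\<in>Ob C. bij_betw (\<phi> Z) (hom C Z W) (S Z)) \<and>
     (\<forall>k\<in>Ar C. \<forall>t\<in>hom C (Cod C k) W.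
        \<phi> (Dom C k) (t \<cdot>\<^bsub>C\<^esub> k) = \<phi> (Cod C k) t \<cdot>\<^bsub>C\<^esub> times_right C k B)"

definition cartesian_closed :: "('o, 'a, 'z) cat_scheme \<Rightarrow> bool" where
  "cartesian_closed C \<longleftrightarrow> category C \<and> (\<exists>T. terminal C T) \<and> has_binary_products C \<and>
     (\<forall>B\<in>Ob C. \<forall>D\<in>Ob C. \<exists>W \<phi>. represents C B (\<lambda>Z. hom C (prd C Z B) D) W \<phi>)"


section \<open>Model categories\<close>

record ('o, 'a) model = "('o, 'a) cat" +
  Fib :: "'a set"
  Cof :: "'a set"
  Weq :: "'a set"

definition has_llp :: "('o, 'a, 'z) cat_scheme \<Rightarrow> 'a \<Rightarrow> 'a \<Rightarrow> bool" where
  "has_llp C i p \<longleftrightarrow>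
     (\<forall>u\<in>hom C (Dom C i) (Dom C p). \<forall>v\<in>hom C (Cod C i) (Cod C p). p \<cdot>\<^bsub>C\<^esub> u = v \<cdot>\<^bsub>C\<^esub> i \<longrightarrow>
        (\<exists>l\<in>hom C (Cod C i) (Dom C p). l \<cdot>\<^bsub>C\<^esub> i = u \<and> p \<cdot>\<^bsub>C\<^esub> l = v))"

definition comp_closed :: "('o, 'a, 'z) cat_scheme \<Rightarrow> 'a set \<Rightarrow> bool" where
  "comp_closed C S \<longleftrightarrow> (\<forall>f\<in>S. \<forall>g\<in>S. Cod C f = Dom C g \<longrightarrow> g \<cdot>\<^bsub>C\<^esub> f \<in> S)"

definition factors_through :: "('o, 'a, 'z) cat_scheme \<Rightarrow> 'a \<Rightarrow> 'a set \<Rightarrow> 'a set \<Rightarrow> bool" where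
  "factors_through C f L R \<longleftrightarrow> (\<exists>i\<in>L. \<exists>p\<in>R. Cod C i = Dom C p \<and> p \<cdot>\<^bsub>C\<^esub> i = f)"

definition model_category :: "('o, 'a, 'z) model_scheme \<Rightarrow> bool" where
  "model_category M \<longleftrightarrow> category M \<and> Fib M \<subseteq> Ar M \<and> Cof M \<subseteq> Ar M \<and> Weq M \<subseteq> Ar M \<and>
     has_finite_limits M \<and> has_finite_colimits M \<and>
     (\<forall>i\<in>Cof M. \<forall>p\<in>Fib M. i \<in> Weq M \<or> p \<in> Weq M \<longrightarrow> has_llp M i p) \<and>
     (\<forall>f\<in>Ar M. factors_through M f (Cof M \<inter> Weq M) (Fib M) \<and>
               factors_through M f (Cof M) (Fib M \<inter> Weq M)) \<and>
     comp_closed M (Fib M) \<and> comp_closed M (Cof M) \<and>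
     (\<forall>f g f' g'. is_pullback M f g f' g' \<and> f \<in> Fib M \<longrightarrow> f' \<in> Fib M) \<and>
     (\<forall>f g f' g'. is_pushout M f g f' g' \<and> f \<in> Cof M \<longrightarrow> f' \<in> Cof M) \<and>
     (\<forall>f. iso M f \<longrightarrow> f \<in> Fib M \<and> f \<in> Cof M) \<and>
     (\<forall>f g f' g'. is_pullback M f g f' g' \<and> f \<in> Fib M \<inter> Weq M \<longrightarrow> f' \<in> Weq M) \<and>
     (\<forall>f g f' g'. is_pushout M f g f' g' \<and> f \<in> Cof M \<inter> Weq M \<longrightarrow> f' \<in> Weq M) \<and>
     (\<forall>f\<in>Ar M. \<forall>g\<in>Ar M. Cod M f = Dom M g \<longrightarrow>
        (f \<in> Weq M \<and> g \<in> Weq M \<longrightarrow> g \<cdot>\<^bsub>M\<^esub> f \<in> Weq M) \<and>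
        (f \<in> Weq M \<and> g \<cdot>\<^bsub>M\<^esub> f \<in> Weq M \<longrightarrow> g \<in> Weq M) \<and>
        (g \<in> Weq M \<and> g \<cdot>\<^bsub>M\<^esub> f \<in> Weq M \<longrightarrow> f \<in> Weq M)) \<and>
     (\<forall>f. iso M f \<longrightarrow> f \<in> Weq M)"

definition fibrant :: "('o, 'a, 'z) model_scheme \<Rightarrow> 'o \<Rightarrow> bool" where
  "fibrant M B \<longleftrightarrow> B \<in> Ob M \<and> (\<exists>T. terminal M T \<and> (\<exists>f\<in>hom M B T. f \<in> Fib M))"

text \<open>Objects of \<open>M/X\<close> are the arrows into \<open>X\<close>; an arrow from \<open>a\<close> to \<open>b\<close> is the triple \<open>(a, h, b)\<close>
  with underlying arrow \<open>h\<close> such that \<open>b \<cdot> h = a\<close>.\<close>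

definition slice_arrows :: "('o, 'a, 'z) cat_scheme \<Rightarrow> 'o \<Rightarrow> ('a \<times> 'a \<times> 'a) set" where
  "slice_arrows C X = {(a, h, b). a \<in> Ar C \<and> Cod C a = X \<and> b \<in> Ar C \<and> Cod C b = X \<and>
     h \<in> hom C (Dom C a) (Dom C b) \<and> b \<cdot>\<^bsub>C\<^esub> h = a}"

definition underlying :: "'a \<times> 'a \<times> 'a \<Rightarrow> 'a" where
  "underlying t = fst (snd t)"

definition slice :: "('o, 'a, 'z) model_scheme \<Rightarrow> 'o \<Rightarrow> ('a, 'a \<times> 'a \<times> 'a) model" where
  "slice M X =
     \<lparr> Ob = {a \<in> Ar M. Cod M a = X},
       Ar = slice_arrows M X,
       Dom = (\<lambda>(a, h, b). a),
       Cod = (\<lambda>(a, h, b). b),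
       Idn = (\<lambda>a. (a, Idn M (Dom M a), a)),
       Comp = (\<lambda>(b', k, c) (a, h, b). (a, k \<cdot>\<^bsub>M\<^esub> h, c)),
       Fib = {t \<in> slice_arrows M X. underlying t \<in> Fib M},
       Cof = {t \<in> slice_arrows M X. underlying t \<in> Cof M},
       Weq = {t \<in> slice_arrows M X. underlying t \<in> Weq M} \<rparr>"


section \<open>Small and universal fibrations\<close>

definition p_small :: "('o, 'a, 'z) cat_scheme \<Rightarrow> 'a \<Rightarrow> 'a \<Rightarrow> bool" where
  "p_small C p f \<longleftrightarrow> (\<exists>x\<in>hom C (Cod C f) (Cod C p). \<exists>x'. is_pullback C p x f x')"

definition universal_fibration :: "('o, 'a, 'z) model_scheme \<Rightarrow> 'a set \<Rightarrow> 'a \<Rightarrow> bool" where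
  "universal_fibration M small p \<longleftrightarrow> p \<in> Fib M \<and> (\<forall>f\<in>small. p_small M p f)"

definition small_fibrations :: "('o, 'a, 'z) model_scheme \<Rightarrow> 'o \<Rightarrow> 'a set" where
  "small_fibrations M bt = {f \<in> Fib M. \<exists>j\<in>hom M bt (Dom M f). j \<in> Weq M \<and> j \<in> Cof M}"


section \<open>(w/f)-Cartesian closed model categories\<close>

definition Hom_w :: "('o, 'a, 'z) model_scheme \<Rightarrow> 'o \<Rightarrow> 'o \<Rightarrow> 'o \<Rightarrow> 'a set" where
  "Hom_w M B D Z = {h \<in> hom M (prd M Z B) D. pairing M Z D (pr1 M Z B) h \<in> Weq M}"

definition wf_cartesian_closed :: "('o, 'a, 'z) model_scheme \<Rightarrow> bool" where
  "wf_cartesian_closed M \<longleftrightarrow> cartesian_closed M \<and>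
     (\<forall>B D. fibrant M B \<and> fibrant M D \<longrightarrow>
        is_subfunctor M B D (Hom_w M B D) \<and>
        (\<exists>W \<phi>. represents M B (Hom_w M B D) W \<phi>))"

definition locally_wf_cartesian_closed :: "('o, 'a, 'z) model_scheme \<Rightarrow> bool" where
  "locally_wf_cartesian_closed M \<longleftrightarrow> (\<forall>X\<in>Ob M. wf_cartesian_closed (slice M X))"

text \<open>A choice of the representing object \<open>D\<^sup>B\<^sub>w\<close> together with the natural isomorphism
  \<open>Hom(Z, D\<^sup>B\<^sub>w) \<rightarrow> Hom\<^sup>(\<^sup>w\<^sup>)(Z \<times> B, D)\<close>.\<close>

definition w_exponential ::
    "('o, 'a, 'z) model_scheme \<Rightarrow> 'o \<Rightarrow> 'o \<Rightarrow> 'o \<times> ('o \<Rightarrow> 'a \<Rightarrow> 'a)" where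
  "w_exponential M D B = (SOME (W, \<phi>). represents M B (Hom_w M B D) W \<phi>)"


section \<open>Univalent fibrations\<close>

definition diagonal :: "('o, 'a, 'z) cat_scheme \<Rightarrow> 'o \<Rightarrow> 'a" where
  "diagonal C B = pairing C B B (Idn C B) (Idn C B)"

definition swap :: "('o, 'a, 'z) cat_scheme \<Rightarrow> 'o \<Rightarrow> 'a" where
  "swap C B = pairing C B B (pr2 C B B) (pr1 C B B)"

text \<open>For \<open>q : E \<rightarrow> B\<close>, the objects \<open>E \<times> B\<close> and \<open>B \<times> E\<close> (both with source \<open>E \<times> B\<close>) of the slice over
  \<open>B \<times> B\<close>.\<close>

definition E_times_B :: "('o, 'a, 'z) cat_scheme \<Rightarrow> 'a \<Rightarrow> 'a" where
  "E_times_B C q = (let E = Dom C q; B = Cod C q in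
     pairing C B B (q \<cdot>\<^bsub>C\<^esub> pr1 C E B) (pr2 C E B))"

definition B_times_E :: "('o, 'a, 'z) cat_scheme \<Rightarrow> 'a \<Rightarrow> 'a" where
  "B_times_E C q = swap C (Cod C q) \<cdot>\<^bsub>C\<^esub> E_times_B C q"

text \<open>The arrow \<open>h\<close> below is the projection of the slice product to its second factor, regarded as
  an arrow with codomain \<open>B_times_E M q\<close> instead of \<open>E_times_B M q\<close>.\<close>

definition univalence_map :: "('o, 'a, 'z) model_scheme \<Rightarrow> 'a \<Rightarrow> 'a \<times> 'a \<times> 'a" where
  "univalence_map M q = (
     let B = Cod M q;
         S = slice M (prd M B B);
         \<delta> = diagonal M B;
         EB = E_times_B M q;
         BE = B_times_E M q;
         h = (prd S \<delta> EB, underlying (pr2 S \<delta> EB), BE);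
         (W, \<phi>) = w_exponential S BE EB
     in THE m. m \<in> hom S \<delta> W \<and> \<phi> \<delta> m = h)"

definition univalent :: "('o, 'a, 'z) model_scheme \<Rightarrow> 'a \<Rightarrow> bool" where
  "univalent M q \<longleftrightarrow> q \<in> Fib M \<and>
     univalence_map M q \<in> Weq (slice M (prd M (Cod M q) (Cod M q)))"

end

theory Submission
  imports Defs
begin

text \<open>Since every arrow is a cofibration, the cobase change of the acyclic \<open>\<bottom> \<rightarrow> U\<close> along \<open>\<bottom> \<rightarrow> K\<close>
  is, for any \<open>K\<close> below \<open>U\<close>, the arrow \<open>K \<rightarrow> U\<close>; by two-out-of-three \<open>\<bottom> \<rightarrow> K\<close> is then acyclic, so it
  lifts against fibrations.  If moreover \<open>K\<close> is below \<open>X\<close>, lifting against a small fibration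
  \<open>Y \<rightarrow> X\<close> puts \<open>K\<close> below \<open>Y\<close>; hence \<open>Y\<close> is the meet of \<open>X\<close> and \<open>U\<close>.

  For univalence, the base of \<open>p\<close> is terminal, so its diagonal is a terminal object of the slice,
  and in a poset every arrow out of a terminal object is an isomorphism.\<close>

section \<open>Arrows, pullbacks and pushouts in posetal categories\<close>

lemma homD: "f \<in> hom C A B \<Longrightarrow> f \<in> Ar C \<and> Dom C f = A \<and> Cod C f = B"
  by (simp add: hom_def)

lemma hom_Ob: "category C \<Longrightarrow> f \<in> hom C A B \<Longrightarrow> A \<in> Ob C \<and> B \<in> Ob C"
  by (auto simp: category_def hom_def)

lemma Idn_in_hom: "category C \<Longrightarrow> A \<in> Ob C \<Longrightarrow> Idn C A \<in> hom C A A"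
  by (simp add: category_def)

lemma Comp_in_hom:
  assumes "category C" "f \<in> hom C A B" "g \<in> hom C B D"
  shows "g \<cdot>\<^bsub>C\<^esub> f \<in> hom C A D"
proof -
  have "\<forall>f\<in>Ar C. \<forall>g\<in>Ar C. Cod C f = Dom C g \<longrightarrow> g \<cdot>\<^bsub>C\<^esub> f \<in> hom C (Dom C f) (Cod C g)"
    using assms(1) by (simp add: category_def)
  then show ?thesis using homD[OF assms(2)] homD[OF assms(3)] by metis
qed

lemma posetal_hom_eq: "posetal C \<Longrightarrow> f \<in> hom C A B \<Longrightarrow> g \<in> hom C A B \<Longrightarrow> f = g"
  by (simp add: posetal_def hom_def)

text \<open>Both composites are endomorphisms, and parallel arrows agree, so they are
  identities.\<close>

lemma posetal_iso:
  assumes "category C" "posetal C" "f \<in> hom C A B" "g \<in> hom C B A"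
  shows "iso C f"
proof -
  have ob: "A \<in> Ob C" "B \<in> Ob C"
    using hom_Ob[OF assms(1,3)] by auto
  have "g \<cdot>\<^bsub>C\<^esub> f = Idn C A" "f \<cdot>\<^bsub>C\<^esub> g = Idn C B"
    by (rule posetal_hom_eq[OF assms(2)] Comp_in_hom[OF assms(1)] Idn_in_hom[OF assms(1)] assms ob)+
  then show ?thesis
    using homD[OF assms(3)] assms(4) unfolding iso_def by auto
qed

text \<open>All equations between parallel arrows are automatic, so only the existence of the
  mediating arrow is left: \<open>P\<close> has to be the meet of \<open>A\<close> and
  \<open>B\<close>.\<close>

lemma posetal_is_pullback:
  assumes "category C" "posetal C"
    and "f \<in> hom C A D" "g \<in> hom C B D" "f' \<in> hom C P B" "g' \<in> hom C P A"
    and "\<And>K x y. x \<in> hom C K A \<Longrightarrow> y \<in> hom C K B \<Longrightarrow> \<exists>t. t \<in> hom C K P"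
  shows "is_pullback C f g f' g'"
proof -
  note H = Comp_in_hom[OF assms(1)] posetal_hom_eq[OF assms(2)]
  have "f \<cdot>\<^bsub>C\<^esub> g' = g \<cdot>\<^bsub>C\<^esub> f'"
    by (rule H(2)[OF H(1)[OF assms(6,3)] H(1)[OF assms(5,4)]])
  moreover have "\<exists>!t. t \<in> hom C K P \<and> g' \<cdot>\<^bsub>C\<^esub> t = x \<and> f' \<cdot>\<^bsub>C\<^esub> t = y"
    if x: "x \<in> hom C K A" and y: "y \<in> hom C K B" for K x y
  proof -
    obtain t where t: "t \<in> hom C K P" using assms(7)[OF x y] by blast
    have "g' \<cdot>\<^bsub>C\<^esub> t = x" "f' \<cdot>\<^bsub>C\<^esub> t = y"
      using H(2)[OF H(1)[OF t assms(6)] x] H(2)[OF H(1)[OF t assms(5)] y] by auto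
    with t H(2)[OF _ t] show ?thesis by blast
  qed
  ultimately show ?thesis
    using homD[OF assms(3)] homD[OF assms(4)] homD[OF assms(5)] homD[OF assms(6)]
    by (simp add: is_pullback_def)
qed

text \<open>With \<open>B\<close> below \<open>D\<close>, the join of \<open>B\<close> and
  \<open>D\<close> is \<open>D\<close> itself. This exhibits \<open>t\<close> as the cobase change
  of \<open>f\<close> along \<open>g\<close>.\<close>

lemma posetal_is_pushout_id:
  assumes "category C" "posetal C"
    and "f \<in> hom C A D" "g \<in> hom C A B" "t \<in> hom C B D"
  shows "is_pushout C f g t (Idn C D)"
proof -
  note H = Comp_in_hom[OF assms(1)] posetal_hom_eq[OF assms(2)]
  have I: "Idn C D \<in> hom C D D"
    using Idn_in_hom[OF assms(1)] hom_Ob[OF assms(1,3)] by auto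
  have "Idn C D \<cdot>\<^bsub>C\<^esub> f = t \<cdot>\<^bsub>C\<^esub> g"
    by (rule H(2)[OF H(1)[OF assms(3) I] H(1)[OF assms(4,5)]])
  moreover have "\<exists>!s. s \<in> hom C D K \<and> s \<cdot>\<^bsub>C\<^esub> Idn C D = x \<and> s \<cdot>\<^bsub>C\<^esub> t = y"
    if x: "x \<in> hom C D K" and y: "y \<in> hom C B K" for K x y
  proof -
    have "x \<cdot>\<^bsub>C\<^esub> Idn C D = x" "x \<cdot>\<^bsub>C\<^esub> t = y"
      using H(2)[OF H(1)[OF I x] x] H(2)[OF H(1)[OF assms(5) x] y] by auto
    with x H(2)[OF _ x] show ?thesis by blast
  qed
  ultimately show ?thesis
    using homD[OF assms(3)] homD[OF assms(4)] homD[OF assms(5)] homD[OF I]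
    by (simp add: is_pushout_def)
qed

section \<open>Chosen binary products and their existence from finite limits\<close>

lemma product_cone_is_product:
  assumes "has_binary_products C" "A \<in> Ob C" "B \<in> Ob C"
  shows "is_product C A B (prd C A B) (pr1 C A B) (pr2 C A B)"
proof -
  have "\<exists>P a b. is_product C A B P a b" using assms by (simp add: has_binary_products_def)
  then have "\<exists>x. case x of (P, a, b) \<Rightarrow> is_product C A B P a b" by auto
  then have "case product_cone C A B of (P, a, b) \<Rightarrow> is_product C A B P a b"
    unfolding product_cone_def by (rule someI_ex)
  then show ?thesis by (simp add: prd_def pr1_def pr2_def split: prod.splits)
qed

lemma pr_in_hom:
  assumes "has_binary_products C" "A \<in> Ob C" "B \<in> Ob C"
  shows "pr1 C A B \<in> hom C (prd C A B) A" "pr2 C A B \<in> hom C (prd C A B) B"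
  using product_cone_is_product[OF assms] by (simp_all add: is_product_def)

lemma pairing_in_hom:
  assumes "category C" "has_binary_products C" "f \<in> hom C K A" "g \<in> hom C K B"
  shows "pairing C A B f g \<in> hom C K (prd C A B)"
proof -
  have "K \<in> Ob C" "A \<in> Ob C" "B \<in> Ob C"
    using hom_Ob[OF assms(1,3)] hom_Ob[OF assms(1,4)] by auto
  then have "\<exists>!t. t \<in> hom C K (prd C A B) \<and> pr1 C A B \<cdot>\<^bsub>C\<^esub> t = f \<and> pr2 C A B \<cdot>\<^bsub>C\<^esub> t = g"
    using product_cone_is_product[OF assms(2), of A B] assms(3,4) by (simp add: is_product_def)
  from theI'[OF this] show ?thesis
    using homD[OF assms(3)] by (simp add: pairing_def)
qed

text \<open>Each number is its own identity arrow; composable arrows are equal, so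
  \<open>Comp\<close> may return either argument.\<close>

definition discrete_pair :: "(nat, nat) cat" where
  "discrete_pair = \<lparr> Ob = {0, 1}, Ar = {0, 1}, Dom = id, Cod = id, Idn = id, Comp = (\<lambda>g f. f) \<rparr>"

lemma finite_shape_discrete_pair: "finite_shape discrete_pair"
  by (auto simp: finite_shape_def category_def hom_def discrete_pair_def)

lemma has_finite_limits_imp_binary_products:
  assumes "category C" "has_finite_limits C"
  shows "has_binary_products C"
  unfolding has_binary_products_def
proof (intro ballI)
  fix A B assume A: "A \<in> Ob C" and B: "B \<in> Ob C"
  define F where "F = (\<lambda>n::nat. if n = 0 then A else B)"
  have idn: "Idn C X \<in> hom C X X" "Idn C X \<cdot>\<^bsub>C\<^esub> Idn C X = Idn C X" if "X \<in> Ob C" for X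
    using assms(1) that by (simp_all add: category_def hom_def, metis)
  have id_left: "Idn C (Cod C f) \<cdot>\<^bsub>C\<^esub> f = f" if "f \<in> Ar C" for f
    using assms(1) that by (simp add: category_def)
  have "cat_functor discrete_pair C F (\<lambda>n. Idn C (F n))"
    using A B idn by (auto simp: cat_functor_def discrete_pair_def F_def)
  then obtain L l where L: "is_limit discrete_pair C F (\<lambda>n. Idn C (F n)) L l"
    using assms(2) finite_shape_discrete_pair unfolding has_finite_limits_def by blast
  \<comment> \<open>Every arrow of the shape is an identity, so the compatibility condition holds by
    itself and a cone is just a pair of arrows.\<close>
  have cone: "cone discrete_pair C F (\<lambda>n. Idn C (F n)) K k \<longleftrightarrow>
      K \<in> Ob C \<and> k 0 \<in> hom C K A \<and> k 1 \<in> hom C K B" for K k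
    using id_left by (auto simp: cone_def discrete_pair_def F_def hom_def)
  have "is_product C A B L (l 0) (l 1)"
    unfolding is_product_def
  proof (intro conjI ballI)
    show "L \<in> Ob C" "l 0 \<in> hom C L A" "l 1 \<in> hom C L B"
      using L cone[of L l] by (simp_all add: is_limit_def)
    fix K x y assume K: "K \<in> Ob C" "x \<in> hom C K A" "y \<in> hom C K B"
    have "cone discrete_pair C F (\<lambda>n. Idn C (F n)) K (\<lambda>n. if n = 0 then x else y)"
      using K cone by simp
    then have "\<exists>!t. t \<in> hom C K L \<and> (\<forall>n\<in>Ob discrete_pair. l n \<cdot>\<^bsub>C\<^esub> t = (if n = 0 then x else y))"
      using L unfolding is_limit_def by blast
    then show "\<exists>!t. t \<in> hom C K L \<and> l 0 \<cdot>\<^bsub>C\<^esub> t = x \<and> l 1 \<cdot>\<^bsub>C\<^esub> t = y"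
      by (simp add: discrete_pair_def)
  qed
  then show "\<exists>P a b. is_product C A B P a b" by blast
qed

section \<open>Model category axioms and slices\<close>

lemma model_categoryD:
  assumes "model_category M"
  shows "category M" "has_finite_limits M" "Fib M \<subseteq> Ar M"
    and "\<And>i p. i \<in> Cof M \<Longrightarrow> p \<in> Fib M \<Longrightarrow> i \<in> Weq M \<Longrightarrow> has_llp M i p"
    and "\<And>f g f' g'. is_pullback M f g f' g' \<Longrightarrow> f \<in> Fib M \<Longrightarrow> f' \<in> Fib M"
    and "\<And>f g f' g'. is_pushout M f g f' g' \<Longrightarrow> f \<in> Cof M \<Longrightarrow> f \<in> Weq M \<Longrightarrow> f' \<in> Weq M"
    and "\<And>f g. f \<in> Ar M \<Longrightarrow> g \<in> Ar M \<Longrightarrow> Cod M f = Dom M g \<Longrightarrow> g \<in> Weq M \<Longrightarrow>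
      g \<cdot>\<^bsub>M\<^esub> f \<in> Weq M \<Longrightarrow> f \<in> Weq M"
    and "\<And>f. iso M f \<Longrightarrow> f \<in> Weq M"
  using assms unfolding model_category_def
  by (elim conjE; (assumption | metis (no_types, lifting) IntI))+

lemma slice_simps:
  "Ob (slice M X) = {a \<in> Ar M. Cod M a = X}"
  "Fib (slice M X) = {t \<in> slice_arrows M X. underlying t \<in> Fib M}"
  "Weq (slice M X) = {t \<in> slice_arrows M X. underlying t \<in> Weq M}"
  by (simp_all add: slice_def)

lemma slice_hom:
  "(a, h, b) \<in> hom (slice M X) a' b' \<longleftrightarrow> a = a' \<and> b = b' \<and> (a, h, b) \<in> slice_arrows M X"
  by (auto simp: hom_def slice_def)

lemma slice_homE:
  assumes "t \<in> hom (slice M X) a b"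
  obtains h where "t = (a, h, b)" "(a, h, b) \<in> slice_arrows M X"
    "h \<in> hom M (Dom M a) (Dom M b)"
  using assms by (cases t) (auto simp: slice_hom slice_arrows_def)

text \<open>The identity of \<open>X\<close> is terminal in the slice, and the unique arrow from
  \<open>f\<close> to it has \<open>f\<close> itself as underlying arrow.\<close>

lemma slice_fibrant:
  assumes "category M" "f \<in> Fib M" "f \<in> hom M A X"
  shows "fibrant (slice M X) f"
proof -
  have I: "Idn M X \<in> hom M X X"
    using Idn_in_hom[OF assms(1)] hom_Ob[OF assms(1,3)] by auto
  have idl: "Idn M (Cod M h) \<cdot>\<^bsub>M\<^esub> h = h" if "h \<in> Ar M" for h
    using assms(1) that by (simp add: category_def)
  have arr: "(a, a, Idn M X) \<in> slice_arrows M X" if "a \<in> Ar M" "Cod M a = X" for a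
    using that idl[OF that(1)] I by (auto simp: slice_arrows_def hom_def)
  have T: "terminal (slice M X) (Idn M X)"
    unfolding terminal_def
  proof (intro conjI ballI)
    show "Idn M X \<in> Ob (slice M X)" using I by (simp add: slice_simps hom_def)
    fix a assume a: "a \<in> Ob (slice M X)"
    show "\<exists>!t. t \<in> hom (slice M X) a (Idn M X)"
    proof (rule ex1I)
      show "(a, a, Idn M X) \<in> hom (slice M X) a (Idn M X)"
        using a arr by (simp add: slice_hom slice_simps)
      fix t assume "t \<in> hom (slice M X) a (Idn M X)"
      then obtain h where h: "t = (a, h, Idn M X)" "(a, h, Idn M X) \<in> slice_arrows M X"
        by (rule slice_homE)
      then have "Idn M X \<cdot>\<^bsub>M\<^esub> h = a" "h \<in> Ar M" "Cod M h = X"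
        using homD[OF I] by (auto simp: slice_arrows_def hom_def)
      then show "t = (a, a, Idn M X)" using idl h(1) by auto
    qed
  qed
  have f: "f \<in> Ar M" "Cod M f = X" using homD[OF assms(3)] by auto
  then have "(f, f, Idn M X) \<in> hom (slice M X) f (Idn M X)"
    "(f, f, Idn M X) \<in> Fib (slice M X)"
    using arr assms(2) by (simp_all add: slice_hom slice_simps underlying_def)
  with T f show ?thesis unfolding fibrant_def by (auto simp: slice_simps)
qed

section \<open>Universality of \<open>p\<close>\<close>

lemma small_fibration_is_pullback:
  fixes Q :: "('o, 'a) model"
  assumes Q: "model_category Q" and pos: "posetal Q" and cof: "Cof Q = Ar Q"
    and bt: "initial Q bt" and tp: "terminal Q tp"
    and i: "i \<in> hom Q bt U" "i \<in> Weq Q"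
    and p: "p \<in> hom Q U tp" "p \<in> Fib Q"
    and f: "f \<in> Fib Q" "j \<in> hom Q bt (Dom Q f)" "j \<in> Weq Q"
  obtains x x' where "x \<in> hom Q (Cod Q f) tp" "is_pullback Q p x f x'"
proof -
  note C = model_categoryD(1)[OF Q]
  note Hom = Comp_in_hom[OF C] and eq = posetal_hom_eq[OF pos]
  have fh: "f \<in> hom Q (Dom Q f) (Cod Q f)"
    using f(1) model_categoryD(3)[OF Q] by (auto simp: hom_def)
  have ob: "Dom Q f \<in> Ob Q" "Cod Q f \<in> Ob Q" using hom_Ob[OF C fh] by auto
  obtain x y where x: "x \<in> hom Q (Cod Q f) tp" and y: "y \<in> hom Q (Dom Q f) tp"
    using tp ob unfolding terminal_def by blast
  \<comment> \<open>An arrow \<open>v\<close> fills in a whole lifting problem: the top side comes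
    from initiality of \<open>bt\<close>, and the square commutes by posetality.\<close>
  have lift: "\<exists>l. l \<in> hom Q K (Dom Q r)"
    if "k \<in> hom Q bt K" "k \<in> Weq Q" "r \<in> Fib Q" "v \<in> hom Q K (Cod Q r)" for k K r v
  proof -
    have r: "r \<in> hom Q (Dom Q r) (Cod Q r)"
      using that(3) model_categoryD(3)[OF Q] by (auto simp: hom_def)
    obtain u where u: "u \<in> hom Q bt (Dom Q r)"
      using bt hom_Ob[OF C r] unfolding initial_def by blast
    have "r \<cdot>\<^bsub>Q\<^esub> u = v \<cdot>\<^bsub>Q\<^esub> k"
      by (rule eq[OF Hom[OF u r] Hom[OF that(1,4)]])
    moreover have "has_llp Q k r"
      using model_categoryD(4)[OF Q] cof that homD[OF that(1)] by simp
    ultimately show ?thesis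
      using u that(4) homD[OF that(1)] unfolding has_llp_def by blast
  qed
  \<comment> \<open>Smallness of \<open>f\<close> is used here: \<open>j\<close> is acyclic, so it
    lifts against \<open>p\<close>.\<close>
  obtain x' where x': "x' \<in> hom Q (Dom Q f) U"
    using lift[OF f(2,3) p(2)] y homD[OF p(1)] by auto
  have "is_pullback Q p x f x'"
  proof (rule posetal_is_pullback[OF C pos p(1) x fh x'])
    fix K a b assume a: "a \<in> hom Q K U" and b: "b \<in> hom Q K (Cod Q f)"
    obtain k where k: "k \<in> hom Q bt K"
      using bt hom_Ob[OF C a] unfolding initial_def by blast
    \<comment> \<open>\<open>a\<close> is the cobase change of the acyclic cofibration
      \<open>i\<close> along \<open>k\<close>.\<close>
    have "a \<in> Weq Q"
      using model_categoryD(6)[OF Q posetal_is_pushout_id[OF C pos i(1) k a]] i cof homD[OF i(1)]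
      by simp
    moreover have "a \<cdot>\<^bsub>Q\<^esub> k = i" by (rule eq[OF Hom[OF k a] i(1)])
    ultimately have "k \<in> Weq Q"
      using model_categoryD(7)[OF Q, of k a] homD[OF k] homD[OF a] i(2) by simp
    then show "\<exists>t. t \<in> hom Q K (Dom Q f)" using lift[OF k _ f(1) b] by blast
  qed
  with x that show thesis by blast
qed

section \<open>Univalence of \<open>p\<close>\<close>

text \<open>Once \<open>univalence_map\<close> is known to be an arrow out of the diagonal, it is a
  weak equivalence because the diagonal has the terminal source \<open>tp\<close>. Most of the work
  is showing that the choices and the description defining this map are well specified.\<close>

lemma posetal_univalent_over_terminal:
  fixes Q :: "('o, 'a) model"
  assumes Q: "model_category Q" and pos: "posetal Q" and tp: "terminal Q tp"
    and p: "p \<in> hom Q U tp" "p \<in> Fib Q"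
    and loc: "locally_wf_cartesian_closed Q"
  shows "univalent Q p"
proof -
  note C = model_categoryD(1)[OF Q]
  note Hom = Comp_in_hom[OF C] and eq = posetal_hom_eq[OF pos]
  note bp = has_finite_limits_imp_binary_products[OF C model_categoryD(2)[OF Q]]
  have ob: "U \<in> Ob Q" "tp \<in> Ob Q" using hom_Ob[OF C p(1)] by auto
  have dc: "Dom Q p = U" "Cod Q p = tp" using homD[OF p(1)] by auto
  define X where "X = prd Q tp tp"
  define S where "S = slice Q X"
  define d where "d = diagonal Q tp"
  define EB where "EB = E_times_B Q p"
  have EB: "EB \<in> hom Q (prd Q U tp) X"
    unfolding EB_def E_times_B_def dc Let_def X_def
    by (intro pairing_in_hom[OF C bp] Hom[OF _ p(1)] pr_in_hom[OF bp] ob)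
  have "swap Q tp \<in> hom Q X X"
    unfolding swap_def X_def by (intro pairing_in_hom[OF C bp] pr_in_hom[OF bp] ob)
  \<comment> \<open>Composing with the swap gives an arrow parallel to \<open>EB\<close>, so the two
    objects of the slice coincide.\<close>
  from Hom[OF EB this] have BE: "B_times_E Q p = EB"
    by (auto intro: eq[OF _ EB] simp: B_times_E_def dc EB_def[symmetric])
  have d: "d \<in> hom Q tp X"
    unfolding d_def diagonal_def X_def by (intro pairing_in_hom[OF C bp] Idn_in_hom[OF C] ob)
  have Xtp: "pr1 Q tp tp \<in> hom Q X tp"
    unfolding X_def by (rule pr_in_hom(1)[OF bp ob(2) ob(2)])
  have Xob: "X \<in> Ob Q" using hom_Ob[OF C Xtp] by simp
  \<comment> \<open>\<open>EB\<close> is a base change of \<open>p\<close>, hence a fibration and a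
    fibrant object of the slice.\<close>
  have "is_pullback Q p (pr1 Q tp tp) EB (pr1 Q U tp)"
  proof (rule posetal_is_pullback[OF C pos p(1) Xtp EB pr_in_hom(1)[OF bp ob]])
    fix K x y assume x: "x \<in> hom Q K U" and "y \<in> hom Q K X"
    from pairing_in_hom[OF C bp x Hom[OF x p(1)]]
    show "\<exists>t. t \<in> hom Q K (prd Q U tp)" by blast
  qed
  then have "EB \<in> Fib Q" using model_categoryD(5)[OF Q] p(2) by blast
  then have fib: "fibrant S EB" unfolding S_def by (rule slice_fibrant[OF C _ EB])
  have wf: "wf_cartesian_closed S"
    using loc Xob by (simp add: locally_wf_cartesian_closed_def S_def)
  then have CS: "category S" "has_binary_products S"
    by (simp_all add: wf_cartesian_closed_def cartesian_closed_def)
  have Sob: "d \<in> Ob S" "EB \<in> Ob S"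
    using homD[OF d] homD[OF EB] by (simp_all add: S_def slice_simps)
  note pr = pr_in_hom[OF CS(2) Sob]
  \<comment> \<open>The reverse arrow \<open>k\<close> is only required in \<open>Q\<close>, not
    over \<open>X\<close>, since weak equivalences of the slice are detected on underlying
    arrows.\<close>
  have Weq_of_inverse: "t \<in> Weq S"
    if t: "t \<in> hom S a b" and k: "k \<in> hom Q (Dom Q b) (Dom Q a)" for t a b k
  proof -
    obtain h where h: "t = (a, h, b)" "(a, h, b) \<in> slice_arrows Q X" "h \<in> hom Q (Dom Q a) (Dom Q b)"
      using t unfolding S_def by (rule slice_homE)
    with model_categoryD(8)[OF Q posetal_iso[OF C pos h(3) k]] show ?thesis
      by (simp add: S_def slice_simps underlying_def)
  qed
  define h where "h = (prd S d EB, underlying (pr2 S d EB), EB)"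
  have h: "h = pr2 S d EB"
    using pr(2) unfolding h_def S_def by (elim slice_homE) (simp add: underlying_def)
  have "h \<in> Hom_w S EB EB d"
  proof -
    have "prd S d EB \<in> Ob S" using hom_Ob[OF CS(1) pr(1)] by simp
    then have "prd S d EB \<in> Ar Q" by (simp add: S_def slice_simps)
    then have "Idn Q (Dom Q (prd S d EB)) \<in> hom Q (Dom Q (prd S d EB)) (Dom Q (prd S d EB))"
      using C by (simp add: category_def)
    \<comment> \<open>The pairing of the two projections is an endomorphism of the product, so an
      identity serves as the reverse arrow.\<close>
    from Weq_of_inverse[OF pairing_in_hom[OF CS pr] this] show ?thesis
      using pr(2) by (simp add: Hom_w_def h)
  qed
  moreover obtain W \<phi> where W: "w_exponential S EB EB = (W, \<phi>)" by fastforce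
  have "\<exists>W \<phi>. represents S EB (Hom_w S EB EB) W \<phi>"
    using wf fib by (simp add: wf_cartesian_closed_def)
  then have "\<exists>z. case z of (W, \<phi>) \<Rightarrow> represents S EB (Hom_w S EB EB) W \<phi>" by auto
  then have "case w_exponential S EB EB of (W, \<phi>) \<Rightarrow> represents S EB (Hom_w S EB EB) W \<phi>"
    unfolding w_exponential_def by (rule someI_ex)
  then have rep: "represents S EB (Hom_w S EB EB) W \<phi>" by (simp add: W)
  then have bij: "bij_betw (\<phi> d) (hom S d W) (Hom_w S EB EB d)" and Wob: "W \<in> Ob S"
    using Sob by (simp_all add: represents_def)
  \<comment> \<open>Bijectivity of \<open>\<phi> d\<close> makes the definite description in
    \<open>univalence_map\<close> denote an actual arrow.\<close>
  ultimately have "\<exists>!m. m \<in> hom S d W \<and> \<phi> d m = h"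
    unfolding bij_betw_def inj_on_def by (metis (no_types, lifting) image_iff)
  from theI'[OF this] have um: "univalence_map Q p \<in> hom S d W"
    unfolding univalence_map_def dc Let_def X_def[symmetric] S_def[symmetric] d_def[symmetric]
      EB_def[symmetric] BE W h_def by simp
  have "Dom Q W \<in> Ob Q"
    using Wob C by (simp add: S_def slice_simps category_def)
  \<comment> \<open>The source of the diagonal is \<open>tp\<close>, so terminality supplies the
    reverse arrow.\<close>
  then obtain k where "k \<in> hom Q (Dom Q W) (Dom Q d)"
    using tp homD[OF d] unfolding terminal_def by blast
  then show ?thesis
    using Weq_of_inverse[OF um] p(2) by (simp add: univalent_def dc S_def X_def)
qed

theorem mainTheorem2:
  fixes Q :: "('o, 'a) model"
    and bt tp U :: 'o
    and i p :: 'a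
  assumes "model_category Q"
    and "posetal Q"
    and "Cof Q = Ar Q"
    and "initial Q bt"
    and "terminal Q tp"
    and "i \<in> hom Q bt U" and "i \<in> Weq Q" and "i \<in> Cof Q"
    and "p \<in> hom Q U tp" and "p \<in> Fib Q"
  shows "universal_fibration Q (small_fibrations Q bt) p \<and>
         (locally_wf_cartesian_closed Q \<longrightarrow> univalent Q p)"
proof (intro conjI impI)
  have "p_small Q p f" if "f \<in> small_fibrations Q bt" for f
  proof -
    from that obtain j where "f \<in> Fib Q" "j \<in> hom Q bt (Dom Q f)" "j \<in> Weq Q"
      by (auto simp: small_fibrations_def)
    then show ?thesis
      using small_fibration_is_pullback[OF assms(1-7,9,10)] homD[OF assms(9)]
      unfolding p_small_def by metis
  qed
  then show "universal_fibration Q (small_fibrations Q bt) p"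
    using assms(10) by (simp add: universal_fibration_def)
next
  assume "locally_wf_cartesian_closed Q"
  then show "univalent Q p"
    by (rule posetal_univalent_over_terminal[OF assms(1,2,5,9,10)])
qed

end
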